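(* Let $\mu$ be a positive integer and let $a,b,c$ be nonnegative integers. There exists a $(2^{(a)},3^{(b)},4^{(c)})$-CD of $\mu K_4$ if and only if both of the following hold: \begin{itemize} \item $2a+3b+4c=6\mu-\delta$, where $\delta=0$ if $\mu$ is even, and $\delta=2$ if $\mu$ is odd; and \item $(b,c)\ne(0,1)$ if $\mu$ is even, and $(b,c)\ne(0,0)$ if $\mu$ is odd. \end{itemize}
   Context: All graphs are finite, loopless and undirected, possibly with multiple (parallel) edges. $\mu K_4$ denotes the multigraph on 4 vertices in which every two distinct vertices are joined by exactly $\mu$ edges. A cycle of length $c\ge 2$ is a connected 2-regular graph with $c$ edges (a cycle of length 2 consists of two distinct parallel edges between two vertices). A 1-factor of a graph is a spanning 1-regular subgraph. A decomposition of a graph is a collection of its subgraphs whose edge sets partition its edge set. A $(2^{(a)},3^{(b)},4^{(c)})$-CD of $\mu K_4$ is a decomposition of $\mu K_4$ into $a$ cycles of length 2, $b$ cycles of length 3 and $c$ cycles of length 4, plus a 1-factor if each vertex has odd degree (that is, if $\mu$ is odd). *)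

theory Defs
  imports Main "HOL-Library.Disjoint_Sets"
begin

text \<open>
  Edges are objects of their own, so that parallel edges are distinct elements of
  the edge set with the same set of ends.
\<close>

record ('v, 'e) multigraph =
  verts :: "'v set"
  edges :: "'e set"
  ends :: "'e \<Rightarrow> 'v set"

definition wf_multigraph :: "('v, 'e) multigraph \<Rightarrow> bool" where
  "wf_multigraph G \<longleftrightarrow>
     finite (verts G) \<and> finite (edges G) \<and>
     (\<forall>e\<in>edges G. ends G e \<subseteq> verts G \<and> card (ends G e) = 2)"

definition degree :: "('v, 'e) multigraph \<Rightarrow> 'v \<Rightarrow> nat" where
  "degree G v = card {e \<in> edges G. v \<in> ends G e}"

definition regular :: "nat \<Rightarrow> ('v, 'e) multigraph \<Rightarrow> bool" where
  "regular k G \<longleftrightarrow> (\<forall>v\<in>verts G. degree G v = k)"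

definition adjacency :: "('v, 'e) multigraph \<Rightarrow> ('v \<times> 'v) set" where
  "adjacency G = {(u, v). \<exists>e\<in>edges G. ends G e = {u, v}}"

definition connected_graph :: "('v, 'e) multigraph \<Rightarrow> bool" where
  "connected_graph G \<longleftrightarrow>
     verts G \<noteq> {} \<and> (\<forall>u\<in>verts G. \<forall>v\<in>verts G. (u, v) \<in> (adjacency G)\<^sup>*)"

text \<open>
  A subgraph keeps the whole function \<open>ends\<close>, whose values outside the edge set are
  irrelevant; it is therefore determined by its vertex and edge sets, and
  counting subgraphs as records is counting subgraphs.
\<close>

definition subgraph :: "('v, 'e) multigraph \<Rightarrow> ('v, 'e) multigraph \<Rightarrow> bool" where
  "subgraph H G \<longleftrightarrow>
     wf_multigraph H \<and> verts H \<subseteq> verts G \<and> edges H \<subseteq> edges G \<and> ends H = ends G"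

definition is_cycle :: "nat \<Rightarrow> ('v, 'e) multigraph \<Rightarrow> bool" where
  "is_cycle c H \<longleftrightarrow>
     c \<ge> 2 \<and> wf_multigraph H \<and> connected_graph H \<and> regular 2 H \<and> card (edges H) = c"

definition one_factor :: "('v, 'e) multigraph \<Rightarrow> ('v, 'e) multigraph \<Rightarrow> bool" where
  "one_factor F G \<longleftrightarrow> subgraph F G \<and> verts F = verts G \<and> regular 1 F"

definition decomposition :: "('v, 'e) multigraph set \<Rightarrow> ('v, 'e) multigraph \<Rightarrow> bool" where
  "decomposition D G \<longleftrightarrow>
     (\<forall>H\<in>D. subgraph H G) \<and> inj_on edges D \<and> partition_on (edges G) (edges ` D)"

text \<open>
  \<open>D\<close> is a $(2^{(a)},3^{(b)},4^{(c)})$-CD of \<open>G\<close>, with \<open>C\<close> the set of its cycles.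
\<close>

definition is_CD234 ::
    "nat \<Rightarrow> nat \<Rightarrow> nat \<Rightarrow> ('v, 'e) multigraph \<Rightarrow> ('v, 'e) multigraph set \<Rightarrow> bool" where
  "is_CD234 a b c G D \<longleftrightarrow>
     decomposition D G \<and>
     (\<exists>C. (\<forall>H\<in>C. is_cycle 2 H \<or> is_cycle 3 H \<or> is_cycle 4 H) \<and>
          card {H \<in> C. is_cycle 2 H} = a \<and>
          card {H \<in> C. is_cycle 3 H} = b \<and>
          card {H \<in> C. is_cycle 4 H} = c \<and>
          (if \<forall>v\<in>verts G. odd (degree G v)
           then \<exists>F. one_factor F G \<and> D = insert F C
           else D = C))"

definition complete_multigraph :: "nat \<Rightarrow> nat \<Rightarrow> (nat, nat set \<times> nat) multigraph" where
  "complete_multigraph \<mu> n =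
     \<lparr> verts = {..<n},
       edges = {S. S \<subseteq> {..<n} \<and> card S = 2} \<times> {..<\<mu>},
       ends = fst \<rparr>"

lemma wf_complete_multigraph: "wf_multigraph (complete_multigraph \<mu> n)"
proof -
  have "finite {S. S \<subseteq> {..<n} \<and> card S = 2}"
    by (rule finite_subset[of _ "Pow {..<n}"]) auto
  then show ?thesis
    by (auto simp: wf_multigraph_def complete_multigraph_def)
qed

lemma card_joining_complete_multigraph:
  assumes "u < n" "v < n" "u \<noteq> v"
  shows "card {e \<in> edges (complete_multigraph \<mu> n).
                 ends (complete_multigraph \<mu> n) e = {u, v}} = \<mu>"
proof -
  have "{e \<in> edges (complete_multigraph \<mu> n).
           ends (complete_multigraph \<mu> n) e = {u, v}} = {{u, v}} \<times> {..<\<mu>}"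
    using assms by (auto simp: complete_multigraph_def)
  then show ?thesis by (simp add: card_cartesian_product)
qed

end

theory Submission
  imports Defs
begin

text \<open>
  Necessity. Counting edges gives the equation; a 1-factor contributes the
  missing 2 edges. The exceptions come from parity of multiplicities: a digon uses an even number
  of the edges joining any given pair of vertices, so after removal of all digons every pair keeps
  the parity of \<open>\<mu>\<close>. If \<open>\<mu>\<close> is even and one 4-cycle is left, that 4-cycle would have only
  multiple edges, and a cycle with this property is a digon (\<open>cycle_even_multiplicities\<close>). If
  \<open>\<mu>\<close> is odd and only a 1-factor is left, that 1-factor would join every pair of vertices.

  Sufficiency. Decompositions of edge-disjoint pieces can be put together, so \<open>\<mu>K\<^sub>4\<close> is cut into
  layers \<open>K\<^sub>4\<close>. Two layers have 12 edges, and each of the six admissible triples for \<open>\<mu> = 2\<close> is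
  realized by an explicit decomposition (\<open>two_layers\<close>). For even \<open>\<mu>\<close>, every admissible triple
  dominates one of these six types in such a way that the difference is again admissible
  (\<open>ex_two_layer_type\<close>), and induction applies. For odd \<open>\<mu>\<close>, one layer is a 1-factor and a
  4-cycle. If removing this 4-cycle leaves an inadmissible triple, then three layers are used
  instead, where three more types are available next to the 1-factor (\<open>three_layers\<close>).
\<close>

section \<open>Counting edges in decompositions\<close>

definition multiplicity :: "('v, 'e) multigraph \<Rightarrow> 'v set \<Rightarrow> nat" where
  "multiplicity G S = card {e \<in> edges G. ends G e = S}"

lemma sum_degree:
  assumes "wf_multigraph G"
  shows "(\<Sum>v\<in>verts G. degree G v) = 2 * card (edges G)"
proof -
  have fin: "finite (verts G)" "finite (edges G)"
    using assms by (auto simp: wf_multigraph_def)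
  have "(\<Sum>v\<in>verts G. degree G v) = (\<Sum>v\<in>verts G. \<Sum>e\<in>edges G. if v \<in> ends G e then 1 else 0)"
    using fin by (simp add: degree_def sum.If_cases Int_def)
  also have "\<dots> = (\<Sum>e\<in>edges G. \<Sum>v\<in>verts G. if v \<in> ends G e then 1 else 0)"
    by (rule sum.swap)
  also have "\<dots> = (\<Sum>e\<in>edges G. 2)"
  proof (rule sum.cong)
    fix e assume "e \<in> edges G"
    then have "ends G e \<subseteq> verts G" "card (ends G e) = 2"
      using assms by (auto simp: wf_multigraph_def)
    moreover from this(1) have "verts G \<inter> {v. v \<in> ends G e} = ends G e" by auto
    ultimately show "(\<Sum>v\<in>verts G. if v \<in> ends G e then 1 else 0) = (2::nat)"
      using fin by (simp add: sum.If_cases)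
  qed simp
  finally show ?thesis by simp
qed

lemma card_edges_regular:
  assumes "wf_multigraph G" "regular k G"
  shows "k * card (verts G) = 2 * card (edges G)"
  using sum_degree[OF assms(1)] assms(2) by (simp add: regular_def mult.commute)

lemma is_cycle_card:
  assumes "is_cycle c H"
  shows "card (edges H) = c" "card (verts H) = c"
  using assms card_edges_regular[of H 2] by (auto simp: is_cycle_def)

lemma is_cycle_unique: "is_cycle c H \<Longrightarrow> is_cycle m H \<longleftrightarrow> m = c"
  by (auto simp: is_cycle_def)

lemma even_multiplicity_digon:
  assumes "is_cycle 2 H"
  shows "even (multiplicity H S)"
proof -
  have wf: "wf_multigraph H" using assms by (simp add: is_cycle_def)
  have "ends H e = verts H" if "e \<in> edges H" for e
    using that wf is_cycle_card[OF assms]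
    by (intro card_subset_eq) (auto simp: wf_multigraph_def)
  then have "{e \<in> edges H. ends H e = S} = (if S = verts H then edges H else {})"
    by auto
  then show ?thesis
    using is_cycle_card[OF assms] by (simp add: multiplicity_def)
qed

text \<open>
  If \<open>e\<close> is an edge between \<open>u\<close> and \<open>v\<close>, then a second edge parallel to \<open>e\<close> exhausts the
  degree of both ends. Hence no edge leaves \<open>{u, v}\<close>, and connectedness does the rest.
\<close>

lemma cycle_even_multiplicities:
  assumes cyc: "is_cycle c H" and even: "\<And>S. even (multiplicity H S)"
  shows "c = 2"
proof -
  have wf: "wf_multigraph H" and conn: "connected_graph H" and reg: "regular 2 H"
    and c: "c \<ge> 2" "card (edges H) = c"
    using cyc by (auto simp: is_cycle_def)
  have fin: "finite (edges H)" "finite (verts H)" using wf by (auto simp: wf_multigraph_def)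
  obtain e where e: "e \<in> edges H" using c by fastforce
  have eS: "ends H e \<subseteq> verts H" "card (ends H e) = 2"
    using wf e by (auto simp: wf_multigraph_def)
  have stay: "ends H e' = ends H e" if "e' \<in> edges H" "w \<in> ends H e" "w \<in> ends H e'" for e' w
  proof -
    let ?A = "{e' \<in> edges H. ends H e' = ends H e}" and ?B = "{e' \<in> edges H. w \<in> ends H e'}"
    have "card ?A \<noteq> 0" using e fin by auto
    moreover have "even (card ?A)" using even[of "ends H e"] by (simp add: multiplicity_def)
    ultimately have "2 \<le> card ?A" by presburger
    moreover have "card ?B = 2"
      using reg eS that(2) by (auto simp: regular_def degree_def)
    moreover have "?A \<subseteq> ?B" using that(2) by auto
    ultimately have "?A = ?B"
      using fin by (intro card_seteq) auto
    then show ?thesis using that by auto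
  qed
  have reach: "y \<in> ends H e" if "(x, y) \<in> (adjacency H)\<^sup>*" "x \<in> ends H e" for x y
    using that
  proof (induction rule: rtrancl_induct)
    case (step y z)
    then obtain e' where "e' \<in> edges H" "ends H e' = {y, z}" by (auto simp: adjacency_def)
    then show ?case using stay[of e' y] step by auto
  qed
  obtain x where "x \<in> ends H e" using eS by fastforce
  then have "verts H \<subseteq> ends H e"
    using reach[of x] conn eS by (auto simp: connected_graph_def)
  then have "verts H = ends H e" using eS by auto
  then show ?thesis using eS is_cycle_card[OF cyc] by simp
qed

lemma finite_decomposition:
  assumes "decomposition D G" "finite (edges G)"
  shows "finite D"
  using assms finite_elements[of "edges G" "edges ` D"]
  by (auto simp: decomposition_def dest: finite_imageD)

lemma sum_card_decomposition:
  assumes "decomposition D G" "finite (edges G)"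
  shows "(\<Sum>H\<in>D. card {e \<in> edges H. Q e}) = card {e \<in> edges G. Q e}"
proof -
  have un: "(\<Union>H\<in>D. edges H) = edges G"
    using assms(1) by (auto simp: decomposition_def partition_on_def)
  have disj: "edges H \<inter> edges H' = {}" if "H \<in> D" "H' \<in> D" "H \<noteq> H'" for H H'
  proof -
    have "edges H \<noteq> edges H'"
      using assms(1) that inj_onD[of edges D H H'] by (auto simp: decomposition_def)
    moreover have "disjoint (edges ` D)"
      using assms(1) by (simp add: decomposition_def partition_on_def)
    ultimately show ?thesis using that(1,2) by (intro disjointD[of "edges ` D"]) auto
  qed
  have "card (\<Union>H\<in>D. {e \<in> edges H. Q e}) = (\<Sum>H\<in>D. card {e \<in> edges H. Q e})"
  proof (rule card_UN_disjoint)
    show "finite D" by (rule finite_decomposition[OF assms])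
    show "\<forall>H\<in>D. finite {e \<in> edges H. Q e}"
      using un by (auto intro!: finite_subset[OF _ assms(2)])
    show "\<forall>H\<in>D. \<forall>H'\<in>D. H \<noteq> H' \<longrightarrow> {e \<in> edges H. Q e} \<inter> {e \<in> edges H'. Q e} = {}"
      using disj by fast
  qed
  moreover have "(\<Union>H\<in>D. {e \<in> edges H. Q e}) = {e \<in> edges G. Q e}"
    using un by auto
  ultimately show ?thesis by simp
qed

lemma sum_multiplicity_decomposition:
  assumes "decomposition D G" "finite (edges G)"
  shows "(\<Sum>H\<in>D. multiplicity H S) = multiplicity G S"
proof -
  have "multiplicity H S = card {e \<in> edges H. ends G e = S}" if "H \<in> D" for H
    using assms(1) that by (simp add: decomposition_def subgraph_def multiplicity_def)
  then show ?thesis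
    using sum_card_decomposition[OF assms, of "\<lambda>e. ends G e = S"]
    by (simp add: multiplicity_def)
qed

lemma sum_card_cycles:
  assumes fin: "finite C"
    and cyc: "\<forall>H\<in>C. is_cycle 2 H \<or> is_cycle 3 H \<or> is_cycle 4 H"
  shows "(\<Sum>H\<in>C. card (edges H)) = 2 * card {H \<in> C. is_cycle 2 H} +
           3 * card {H \<in> C. is_cycle 3 H} + 4 * card {H \<in> C. is_cycle 4 H}"
proof -
  have "card (edges H) = 2 * of_bool (is_cycle 2 H) + 3 * of_bool (is_cycle 3 H) +
      4 * of_bool (is_cycle 4 H)" if H: "H \<in> C" for H
  proof -
    obtain k where k: "is_cycle k H" "k = 2 \<or> k = 3 \<or> k = 4" using cyc H by blast
    show ?thesis
      unfolding is_cycle_unique[OF k(1)] is_cycle_card(1)[OF k(1)] using k(2) by auto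
  qed
  then have "(\<Sum>H\<in>C. card (edges H)) = (\<Sum>H\<in>C. 2 * of_bool (is_cycle 2 H) +
      3 * of_bool (is_cycle 3 H) + 4 * of_bool (is_cycle 4 H))"
    by (rule sum.cong[OF refl])
  also have "\<dots> = 2 * (\<Sum>H\<in>C. of_bool (is_cycle 2 H)) + 3 * (\<Sum>H\<in>C. of_bool (is_cycle 3 H)) +
      4 * (\<Sum>H\<in>C. of_bool (is_cycle 4 H))"
    by (simp add: sum.distrib sum_distrib_left)
  finally show ?thesis
    using fin by (simp add: sum_of_bool_eq Int_def)
qed

section \<open>The graph \<open>\<mu>K\<^sub>4\<close>\<close>

abbreviation K4 :: "nat \<Rightarrow> (nat, nat set \<times> nat) multigraph" where
  "K4 \<mu> \<equiv> complete_multigraph \<mu> 4"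

definition pairs4 :: "nat set set" where
  "pairs4 = {{0,1},{0,2},{0,3},{1,2},{1,3},{2,3}}"

lemma K4_simps [simp]:
  "verts (K4 \<mu>) = {0,1,2,3}" "edges (K4 \<mu>) = pairs4 \<times> {..<\<mu>}" "ends (K4 \<mu>) = fst"
proof -
  have V: "{..<4::nat} = {0,1,2,3}" by auto
  have "{S. S \<subseteq> {..<4::nat} \<and> card S = 2} = pairs4" (is "?L = _")
  proof
    show "?L \<subseteq> pairs4"
    proof
      fix S assume "S \<in> ?L"
      then obtain x y where xy: "S = {x, y}" "x \<noteq> y" "x \<in> {0,1,2,3}" "y \<in> {0,1,2,3}"
        unfolding V card_2_iff by blast
      then show "S \<in> pairs4" by (elim insertE) (simp_all add: pairs4_def doubleton_eq_iff)
    qed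
    show "pairs4 \<subseteq> ?L" by (auto simp: pairs4_def)
  qed
  then show "verts (K4 \<mu>) = {0,1,2,3}" "edges (K4 \<mu>) = pairs4 \<times> {..<\<mu>}" "ends (K4 \<mu>) = fst"
    by (auto simp: complete_multigraph_def)
qed

lemma finite_edges_K4: "finite (edges (K4 \<mu>))"
  by (simp add: pairs4_def)

lemma card_edges_K4: "card (edges (K4 \<mu>)) = 6 * \<mu>"
  by (simp add: pairs4_def card_cartesian_product doubleton_eq_iff)

lemma multiplicity_K4:
  assumes "S \<in> pairs4"
  shows "multiplicity (K4 \<mu>) S = \<mu>"
proof -
  have "{e \<in> edges (K4 \<mu>). ends (K4 \<mu>) e = S} = {S} \<times> {..<\<mu>}"
    using assms by auto
  then show ?thesis by (simp add: multiplicity_def card_cartesian_product)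
qed

lemma degree_K4:
  assumes "v \<in> verts (K4 \<mu>)"
  shows "degree (K4 \<mu>) v = 3 * \<mu>"
proof -
  have "{e \<in> edges (K4 \<mu>). v \<in> ends (K4 \<mu>) e} = {S \<in> pairs4. v \<in> S} \<times> {..<\<mu>}"
    by auto
  moreover have "card {S \<in> pairs4. v \<in> S} = 3"
  proof -
    have "v = 0 \<or> v = 1 \<or> v = 2 \<or> v = 3" using assms by simp
    moreover have "card {S \<in> pairs4. v \<in> S} = (\<Sum>S\<in>pairs4. if v \<in> S then 1 else 0)"
      by (simp add: pairs4_def sum.If_cases Int_def)
    ultimately show ?thesis by (auto simp: pairs4_def doubleton_eq_iff)
  qed
  ultimately show ?thesis by (simp add: degree_def card_cartesian_product)
qed

lemma all_degrees_odd_K4: "(\<forall>v\<in>verts (K4 \<mu>). odd (degree (K4 \<mu>) v)) \<longleftrightarrow> odd \<mu>"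
proof -
  have "verts (K4 \<mu>) \<noteq> {}" by simp
  then show ?thesis by (auto simp: degree_K4 simp del: K4_simps)
qed

section \<open>Necessity\<close>

lemma CD_K4_necessary:
  assumes "is_CD234 a b c (K4 \<mu>) D"
  shows "2 * a + 3 * b + 4 * c = 6 * \<mu> - (if even \<mu> then 0 else 2)"
    and "if even \<mu> then (b, c) \<noteq> (0, 1) else (b, c) \<noteq> (0, 0)"
proof -
  obtain C where dec: "decomposition D (K4 \<mu>)"
    and cyc: "\<forall>H\<in>C. is_cycle 2 H \<or> is_cycle 3 H \<or> is_cycle 4 H"
    and abc: "card {H \<in> C. is_cycle 2 H} = a" "card {H \<in> C. is_cycle 3 H} = b"
      "card {H \<in> C. is_cycle 4 H} = c"
    and D: "if odd \<mu> then \<exists>F. one_factor F (K4 \<mu>) \<and> D = insert F C else D = C"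
    using assms unfolding is_CD234_def all_degrees_odd_K4 by auto
  have finD: "finite D" using finite_decomposition[OF dec finite_edges_K4] .
  then have finC: "finite C" using D by (auto split: if_splits)
  have total: "(\<Sum>H\<in>D. card (edges H)) = 6 * \<mu>"
    using sum_card_decomposition[OF dec finite_edges_K4, of "\<lambda>_. True"] card_edges_K4[of \<mu>]
    by simp
  have mult: "(\<Sum>H\<in>D. multiplicity H S) = \<mu>" if "S \<in> pairs4" for S
    using sum_multiplicity_decomposition[OF dec finite_edges_K4] multiplicity_K4[OF that] by simp
  have sumC: "(\<Sum>H\<in>C. card (edges H)) = 2 * a + 3 * b + 4 * c"
    using sum_card_cycles[OF finC cyc] abc by simp
  have "2 * a + 3 * b + 4 * c = 6 * \<mu> - (if even \<mu> then 0 else 2) \<and>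
    (if even \<mu> then (b, c) \<noteq> (0, 1) else (b, c) \<noteq> (0, 0))"
  proof (cases "even \<mu>")
    case True
    then have [simp]: "D = C" using D by simp
    have "False" if bc: "b = 0" "c = 1"
    proof -
      obtain X where X: "{H \<in> C. is_cycle 4 H} = {X}"
        using abc(3) bc card_1_singletonE by metis
      have no3: "{H \<in> C. is_cycle 3 H} = {}" using abc(2) bc finC by simp
      have XC: "X \<in> C" "is_cycle 4 X" using X by auto
      have digon: "is_cycle 2 H" if "H \<in> C - {X}" for H
        using that cyc X no3 by blast
      have "even (multiplicity X S)" for S
      proof (cases "S \<in> pairs4")
        case True
        have "multiplicity X S + (\<Sum>H\<in>C - {X}. multiplicity H S) = \<mu>"
          using mult[OF True] sum.remove[OF finC XC(1), of "\<lambda>H. multiplicity H S"] by simp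
        moreover have "even (\<Sum>H\<in>C - {X}. multiplicity H S)"
          by (rule dvd_sum) (use digon even_multiplicity_digon in blast)
        ultimately show ?thesis using \<open>even \<mu>\<close> by presburger
      next
        case False
        have "ends X e \<in> pairs4" if "e \<in> edges X" for e
        proof -
          have "subgraph X (K4 \<mu>)" using dec XC(1) by (auto simp: decomposition_def)
          then show ?thesis using that by (auto simp: subgraph_def)
        qed
        then have "{e \<in> edges X. ends X e = S} = {}" using False by auto
        then show ?thesis by (simp only: multiplicity_def) simp
      qed
      from cycle_even_multiplicities[OF XC(2) this] show False by simp
    qed
    then show ?thesis using True total sumC by auto
  next
    case False
    then obtain F where F: "one_factor F (K4 \<mu>)" and D': "D = insert F C" using D by auto
    have Fwf: "wf_multigraph F" and Freg: "regular 1 F" and FV: "verts F = {0,1,2,3}"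
      using F by (auto simp: one_factor_def subgraph_def)
    have cardF: "card (edges F) = 2" using card_edges_regular[OF Fwf Freg] FV by simp
    have FC: "F \<notin> C"
    proof
      assume "F \<in> C"
      then have "regular 2 F" using cyc by (auto simp: is_cycle_def)
      then show False using Freg FV by (auto simp: regular_def)
    qed
    have "False" if bc: "b = 0" "c = 0"
    proof -
      have "{H \<in> C. is_cycle 3 H} = {}" "{H \<in> C. is_cycle 4 H} = {}"
        using abc bc finC by simp_all
      then have digon: "is_cycle 2 H" if "H \<in> C" for H
        using that cyc by blast
      have "\<exists>e\<in>edges F. ends F e = S" if "S \<in> pairs4" for S
      proof -
        have "multiplicity F S + (\<Sum>H\<in>C. multiplicity H S) = \<mu>"
          using mult[OF that] finC FC D' by simp
        moreover have "even (\<Sum>H\<in>C. multiplicity H S)"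
          by (rule dvd_sum) (use digon even_multiplicity_digon in blast)
        ultimately have "odd (multiplicity F S)" using False by presburger
        then have "{e \<in> edges F. ends F e = S} \<noteq> {}"
          unfolding multiplicity_def by (rule contrapos_nn) (simp only: card.empty even_zero)
        then show ?thesis by auto
      qed
      then have "\<exists>e\<in>edges F. ends F e = {0,1}" "\<exists>f\<in>edges F. ends F f = {0,2}"
        by (simp_all add: pairs4_def)
      then obtain e f
        where ef: "e \<in> edges F" "f \<in> edges F" "ends F e = {0,1}" "ends F f = {0,2}"
        by blast
      have "card {e, f} \<le> degree F 0"
        unfolding degree_def using ef Fwf by (intro card_mono) (auto simp: wf_multigraph_def)
      moreover have "e \<noteq> f"
      proof
        assume "e = f"
        then have "{0, 1} = {0, 2 :: nat}" using ef(3,4) by simp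
        then show False by (simp add: doubleton_eq_iff)
      qed
      ultimately show False using Freg FV by (simp add: regular_def)
    qed
    moreover have "2 * a + 3 * b + 4 * c + 2 = 6 * \<mu>"
      using total sumC finC FC cardF by (simp add: D')
    ultimately show ?thesis using False by auto
  qed
  then show "2 * a + 3 * b + 4 * c = 6 * \<mu> - (if even \<mu> then 0 else 2)"
    "if even \<mu> then (b, c) \<noteq> (0, 1) else (b, c) \<noteq> (0, 0)" by blast+
qed

section \<open>Assembling cycle decompositions\<close>

text \<open>
  Decompositions are built for arbitrary edge sets \<open>E\<close> in place of a whole graph, so that pieces can
  be joined and the edges of the 1-factor can be left out. Since cycles have edges,
  disjointness of the family already makes \<open>edges\<close> injective on \<open>C\<close>.
\<close>

definition cycle_decomp ::
    "('v, 'e) multigraph \<Rightarrow> nat \<Rightarrow> nat \<Rightarrow> nat \<Rightarrow> 'e set \<Rightarrow> bool" where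
  "cycle_decomp G a b c E \<longleftrightarrow>
     (\<exists>C. finite C \<and> (\<forall>H\<in>C. subgraph H G) \<and>
          (\<forall>H\<in>C. is_cycle 2 H \<or> is_cycle 3 H \<or> is_cycle 4 H) \<and>
          disjoint_family_on edges C \<and> (\<Union>H\<in>C. edges H) = E \<and>
          card {H \<in> C. is_cycle 2 H} = a \<and>
          card {H \<in> C. is_cycle 3 H} = b \<and>
          card {H \<in> C. is_cycle 4 H} = c)"

lemma cycle_edges_nonempty: "is_cycle c H \<Longrightarrow> edges H \<noteq> {}"
  using is_cycle_card[of c H] by (auto simp: is_cycle_def)

lemma cycle_decomp_empty: "cycle_decomp G 0 0 0 {}"
  unfolding cycle_decomp_def by (intro exI[of _ "{}"]) (simp add: disjoint_family_on_def)

lemma cycle_decomp_Un: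
  assumes "cycle_decomp G a b c E" "cycle_decomp G a' b' c' E'" "E \<inter> E' = {}"
  shows "cycle_decomp G (a + a') (b + b') (c + c') (E \<union> E')"
proof -
  obtain C where C: "finite C" "\<forall>H\<in>C. subgraph H G"
    "\<forall>H\<in>C. is_cycle 2 H \<or> is_cycle 3 H \<or> is_cycle 4 H"
    "disjoint_family_on edges C" "(\<Union>H\<in>C. edges H) = E"
    "card {H \<in> C. is_cycle 2 H} = a" "card {H \<in> C. is_cycle 3 H} = b"
    "card {H \<in> C. is_cycle 4 H} = c"
    using assms(1) by (auto simp: cycle_decomp_def)
  obtain C' where C': "finite C'" "\<forall>H\<in>C'. subgraph H G"
    "\<forall>H\<in>C'. is_cycle 2 H \<or> is_cycle 3 H \<or> is_cycle 4 H"
    "disjoint_family_on edges C'" "(\<Union>H\<in>C'. edges H) = E'"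
    "card {H \<in> C'. is_cycle 2 H} = a'" "card {H \<in> C'. is_cycle 3 H} = b'"
    "card {H \<in> C'. is_cycle 4 H} = c'"
    using assms(2) by (auto simp: cycle_decomp_def)
  have disj: "edges H \<inter> edges H' = {}" if "H \<in> C" "H' \<in> C'" for H H'
    using that C(5) C'(5) assms(3) by blast
  have CC': "C \<inter> C' = {}"
  proof (rule ccontr)
    assume "C \<inter> C' \<noteq> {}"
    then obtain H where "H \<in> C" "H \<in> C'" by auto
    then show False using disj[of H H] C(3) cycle_edges_nonempty by blast
  qed
  have count: "card {H \<in> C \<union> C'. P H} = card {H \<in> C. P H} + card {H \<in> C'. P H}" for P
  proof -
    have "{H \<in> C \<union> C'. P H} = {H \<in> C. P H} \<union> {H \<in> C'. P H}" by auto
    moreover have "{H \<in> C. P H} \<inter> {H \<in> C'. P H} = {}" using CC' by auto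
    ultimately show ?thesis using C(1) C'(1) by (simp add: card_Un_disjoint)
  qed
  have "disjoint_family_on edges (C \<union> C')"
    using C(4) C'(4) disj unfolding disjoint_family_on_def by (metis Int_commute Un_iff)
  then show ?thesis
    unfolding cycle_decomp_def
    by (intro exI[of _ "C \<union> C'"]) (use C C' count in auto)
qed

lemma cycle_decomp_Un_Diff:
  assumes "cycle_decomp G a b c (A - F)" "cycle_decomp G a' b' c' B" "A \<inter> B = {}" "F \<subseteq> A"
  shows "cycle_decomp G (a + a') (b + b') (c + c') (A \<union> B - F)"
proof -
  have "A \<union> B - F = (A - F) \<union> B" "(A - F) \<inter> B = {}" using assms(3,4) by blast+
  then show ?thesis using cycle_decomp_Un[OF assms(1,2)] by simp
qed

lemma cycle_decomp_single:
  assumes H: "is_cycle n H" and "n = 2 \<or> n = 3 \<or> n = 4" "subgraph H G"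
  shows "cycle_decomp G (if n = 2 then 1 else 0) (if n = 3 then 1 else 0)
    (if n = 4 then 1 else 0) (edges H)"
proof -
  have "{H' \<in> {H}. is_cycle m H'} = (if m = n then {H} else {})" for m
    using is_cycle_unique[OF H, of m] by auto
  then show ?thesis
    unfolding cycle_decomp_def
    by (intro exI[of _ "{H}"]) (use assms in \<open>auto simp: disjoint_family_on_def\<close>)
qed

lemma connected_graph_from_root:
  assumes "r \<in> verts G" "\<And>v. v \<in> verts G \<Longrightarrow> (r, v) \<in> (adjacency G)\<^sup>*"
  shows "connected_graph G"
proof -
  have "sym (adjacency G)" by (auto simp: sym_def adjacency_def insert_commute)
  then have "sym ((adjacency G)\<^sup>*)" by (rule sym_rtrancl)
  then show ?thesis
    using assms unfolding connected_graph_def by (metis empty_iff rtrancl_trans symD)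
qed

lemma degree_conv_sum:
  "finite (edges G) \<Longrightarrow> degree G v = (\<Sum>e\<in>edges G. if v \<in> ends G e then 1 else 0)"
  by (simp add: degree_def sum.If_cases Int_def)

lemma cycle_decomp_digon:
  assumes wf: "wf_multigraph G" and "cycle_decomp G a b c E"
    and e: "{e, f} \<subseteq> edges G" "ends G e = {u, v}" "ends G f = {u, v}" "e \<noteq> f"
    and new: "{e, f} \<inter> E = {}"
  shows "cycle_decomp G (Suc a) b c (insert e (insert f E))"
proof -
  define H where "H = \<lparr>verts = {u, v}, edges = {e, f}, ends = ends G\<rparr>"
  have H: "verts H = {u, v}" "edges H = {e, f}" "ends H = ends G" by (simp_all add: H_def)
  have V: "{u, v} \<subseteq> verts G" "card {u, v} = 2" using wf e by (auto simp: wf_multigraph_def)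
  then have uv: "u \<noteq> v" by auto
  have "(u, v) \<in> adjacency H" using e H by (auto simp: adjacency_def)
  then have "connected_graph H"
    by (intro connected_graph_from_root[of u]) (auto simp: H)
  moreover have "wf_multigraph H" using V e by (auto simp: wf_multigraph_def H)
  moreover have "regular 2 H" using e uv by (simp add: regular_def degree_conv_sum H)
  ultimately have "is_cycle 2 H" using e by (simp add: is_cycle_def H)
  then have "cycle_decomp G 1 0 0 (edges H)"
    using cycle_decomp_single[of 2 H G] V e \<open>wf_multigraph H\<close> by (auto simp: subgraph_def H)
  then have "cycle_decomp G (1 + a) (0 + b) (0 + c) (edges H \<union> E)"
    using assms(2) new by (intro cycle_decomp_Un) (auto simp: H)
  then show ?thesis by (simp add: H)
qed

lemma cycle_decomp_triangle:
  assumes wf: "wf_multigraph G" and "cycle_decomp G a b c E"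
    and e: "{e, f, g} \<subseteq> edges G" "ends G e = {u, v}" "ends G f = {v, w}" "ends G g = {w, u}"
    and new: "{e, f, g} \<inter> E = {}" and uvw: "distinct [u, v, w]"
  shows "cycle_decomp G a (Suc b) c (insert e (insert f (insert g E)))"
proof -
  define H where "H = \<lparr>verts = {u, v, w}, edges = {e, f, g}, ends = ends G\<rparr>"
  have H: "verts H = {u, v, w}" "edges H = {e, f, g}" "ends H = ends G" by (simp_all add: H_def)
  have V: "{u, v, w} \<subseteq> verts G" using wf e by (force simp: wf_multigraph_def)
  have d: "e \<noteq> f" "e \<noteq> g" "f \<noteq> g" using e uvw by (auto simp: doubleton_eq_iff)
  have "(u, v) \<in> adjacency H" "(v, w) \<in> adjacency H" using e H by (auto simp: adjacency_def)
  then have "connected_graph H"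
    by (intro connected_graph_from_root[of u]) (auto simp: H)
  moreover have "wf_multigraph H" using uvw e by (auto simp: wf_multigraph_def H)
  moreover have "regular 2 H" using e uvw d by (auto simp: regular_def degree_conv_sum H)
  ultimately have "is_cycle 3 H" using d by (simp add: is_cycle_def H)
  then have "cycle_decomp G 0 1 0 (edges H)"
    using cycle_decomp_single[of 3 H G] V e \<open>wf_multigraph H\<close> by (auto simp: subgraph_def H)
  then have "cycle_decomp G (0 + a) (1 + b) (0 + c) (edges H \<union> E)"
    using assms(2) new by (intro cycle_decomp_Un) (auto simp: H)
  then show ?thesis by (simp add: H)
qed

lemma cycle_decomp_square:
  assumes wf: "wf_multigraph G" and "cycle_decomp G a b c E"
    and e: "{e, f, g, h} \<subseteq> edges G" "ends G e = {u, v}" "ends G f = {v, w}"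
      "ends G g = {w, x}" "ends G h = {x, u}"
    and new: "{e, f, g, h} \<inter> E = {}" and uvwx: "distinct [u, v, w, x]"
  shows "cycle_decomp G a b (Suc c) (insert e (insert f (insert g (insert h E))))"
proof -
  define H where "H = \<lparr>verts = {u, v, w, x}, edges = {e, f, g, h}, ends = ends G\<rparr>"
  have H: "verts H = {u, v, w, x}" "edges H = {e, f, g, h}" "ends H = ends G"
    by (simp_all add: H_def)
  have V: "{u, v, w, x} \<subseteq> verts G" using wf e by (force simp: wf_multigraph_def)
  have d: "e \<noteq> f" "e \<noteq> g" "e \<noteq> h" "f \<noteq> g" "f \<noteq> h" "g \<noteq> h"
    using e uvwx by (auto simp: doubleton_eq_iff)
  have "(u, v) \<in> adjacency H" "(v, w) \<in> adjacency H" "(w, x) \<in> adjacency H"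
    using e H by (auto simp: adjacency_def)
  then have "connected_graph H"
    by (intro connected_graph_from_root[of u]) (auto simp: H intro: rtrancl_trans)
  moreover have "wf_multigraph H" using uvwx e by (auto simp: wf_multigraph_def H)
  moreover have "regular 2 H" using e uvwx d by (auto simp: regular_def degree_conv_sum H)
  ultimately have "is_cycle 4 H" using d by (simp add: is_cycle_def H)
  then have "cycle_decomp G 0 0 1 (edges H)"
    using cycle_decomp_single[of 4 H G] V e \<open>wf_multigraph H\<close> by (auto simp: subgraph_def H)
  then have "cycle_decomp G (0 + a) (0 + b) (1 + c) (edges H \<union> E)"
    using assms(2) new by (intro cycle_decomp_Un) (auto simp: H)
  then show ?thesis by (simp add: H)
qed

lemma decomposition_of_cycles:
  assumes "\<forall>H\<in>C. subgraph H G" "disjoint_family_on edges C" "(\<Union>H\<in>C. edges H) = edges G"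
    "\<forall>H\<in>C. edges H \<noteq> {}"
  shows "decomposition C G"
proof -
  have disj: "edges H \<inter> edges H' = {}" if "H \<in> C" "H' \<in> C" "H \<noteq> H'" for H H'
    using assms(2) that by (simp add: disjoint_family_on_def)
  have "inj_on edges C"
  proof (rule inj_onI)
    fix H H' assume "H \<in> C" "H' \<in> C" "edges H = edges H'"
    then show "H = H'" using disj[of H H'] assms(4) by auto
  qed
  moreover have "partition_on (edges G) (edges ` C)"
  proof (rule partition_onI)
    show "\<Union> (edges ` C) = edges G" by (rule assms(3))
    show "{} \<notin> edges ` C" using assms(4) by auto
    show "disjnt p q" if "p \<in> edges ` C" "q \<in> edges ` C" "p \<noteq> q" for p q
      using that disj unfolding disjnt_def by auto
  qed
  ultimately show ?thesis using assms(1) by (simp add: decomposition_def)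
qed

lemma CD_of_cycle_decomp_even:
  assumes "even \<mu>" "cycle_decomp (K4 \<mu>) a b c (edges (K4 \<mu>))"
  shows "\<exists>D. is_CD234 a b c (K4 \<mu>) D"
proof -
  obtain C where C: "\<forall>H\<in>C. subgraph H (K4 \<mu>)"
    "\<forall>H\<in>C. is_cycle 2 H \<or> is_cycle 3 H \<or> is_cycle 4 H"
    "disjoint_family_on edges C" "(\<Union>H\<in>C. edges H) = edges (K4 \<mu>)"
    "card {H \<in> C. is_cycle 2 H} = a" "card {H \<in> C. is_cycle 3 H} = b"
    "card {H \<in> C. is_cycle 4 H} = c"
    using assms(2) unfolding cycle_decomp_def by blast
  have "decomposition C (K4 \<mu>)"
    using C cycle_edges_nonempty by (intro decomposition_of_cycles) blast+
  then show ?thesis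
    unfolding is_CD234_def all_degrees_odd_K4 using C assms(1) by auto
qed

lemma CD_of_cycle_decomp_odd:
  assumes "odd \<mu>" "i < \<mu>"
    and dec: "cycle_decomp (K4 \<mu>) a b c (edges (K4 \<mu>) - {({0,1}, i), ({2,3}, i)})"
  shows "\<exists>D. is_CD234 a b c (K4 \<mu>) D"
proof -
  define F where "F = \<lparr>verts = {0,1,2,3::nat}, edges = {({0,1}, i), ({2,3}, i)}, ends = fst\<rparr>"
  have F: "verts F = {0,1,2,3}" "edges F = {({0,1}, i), ({2,3}, i)}" "ends F = fst"
    by (simp_all add: F_def)
  have wfF: "wf_multigraph F" by (auto simp: wf_multigraph_def F)
  have FG: "edges F \<subseteq> edges (K4 \<mu>)" using assms(2) by (auto simp: F pairs4_def)
  have sub: "subgraph F (K4 \<mu>)" unfolding subgraph_def using wfF FG F by simp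
  have "regular 1 F" by (simp add: regular_def degree_conv_sum F doubleton_eq_iff)
  then have fac: "one_factor F (K4 \<mu>)" using sub F by (simp add: one_factor_def)
  obtain C where C: "\<forall>H\<in>C. subgraph H (K4 \<mu>)"
    "\<forall>H\<in>C. is_cycle 2 H \<or> is_cycle 3 H \<or> is_cycle 4 H"
    "disjoint_family_on edges C" "(\<Union>H\<in>C. edges H) = edges (K4 \<mu>) - edges F"
    "card {H \<in> C. is_cycle 2 H} = a" "card {H \<in> C. is_cycle 3 H} = b"
    "card {H \<in> C. is_cycle 4 H} = c"
    using dec unfolding cycle_decomp_def F by blast
  have disj: "edges F \<inter> edges H = {}" if "H \<in> C" for H using C(4) that by blast
  have "disjoint_family_on edges (insert F C)"
    using C(3) disj unfolding disjoint_family_on_def by (metis Int_commute insert_iff)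
  moreover have "\<forall>H\<in>insert F C. edges H \<noteq> {}"
    using C(2) cycle_edges_nonempty F by blast
  moreover have "(\<Union>H\<in>insert F C. edges H) = edges (K4 \<mu>)" using C(4) FG by auto
  ultimately have "decomposition (insert F C) (K4 \<mu>)"
    using C(1) sub by (intro decomposition_of_cycles) auto
  then show ?thesis
    unfolding is_CD234_def all_degrees_odd_K4 using C assms(1) fac by auto
qed

section \<open>Explicit decompositions of a few layers\<close>

text \<open>
  Each cycle below is listed in cyclic order, so the set of its edges has to be compared with the
  layers up to the orientation of the pairs.
\<close>

lemma pair_orientation:
  "{2,0} = {0,2::nat}" "{3,0} = {0,3::nat}" "{2,1} = {1,2::nat}" "{3,1} = {1,3::nat}"
  "{3,2} = {2,3::nat}"
  by (rule insert_commute)+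

lemma pairs4_Times:
  "pairs4 \<times> L = (\<Union>k\<in>L. {({0,1},k), ({0,2},k), ({0,3},k), ({1,2},k), ({1,3},k), ({2,3},k)})"
  unfolding pairs4_def by blast

lemma K4_digon:
  assumes "cycle_decomp (K4 \<mu>) a b c E" "{u, v} \<in> pairs4" "i < \<mu>" "j < \<mu>" "i \<noteq> j"
    "({u, v}, i) \<notin> E" "({u, v}, j) \<notin> E"
  shows "cycle_decomp (K4 \<mu>) (Suc a) b c (insert ({u, v}, i) (insert ({u, v}, j) E))"
  using assms by (intro cycle_decomp_digon[OF wf_complete_multigraph]) auto

lemma K4_triangle:
  assumes "cycle_decomp (K4 \<mu>) a b c E" "{u, v} \<in> pairs4" "{v, w} \<in> pairs4" "{w, u} \<in> pairs4"
    "i < \<mu>" "j < \<mu>" "k < \<mu>" "distinct [u, v, w]"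
    "({u, v}, i) \<notin> E" "({v, w}, j) \<notin> E" "({w, u}, k) \<notin> E"
  shows "cycle_decomp (K4 \<mu>) a (Suc b) c
    (insert ({u, v}, i) (insert ({v, w}, j) (insert ({w, u}, k) E)))"
  by (rule cycle_decomp_triangle[OF wf_complete_multigraph assms(1)]) (use assms in auto)

lemma K4_square:
  assumes "cycle_decomp (K4 \<mu>) a b c E"
    "{u, v} \<in> pairs4" "{v, w} \<in> pairs4" "{w, x} \<in> pairs4" "{x, u} \<in> pairs4"
    "i < \<mu>" "j < \<mu>" "k < \<mu>" "l < \<mu>" "distinct [u, v, w, x]"
    "({u, v}, i) \<notin> E" "({v, w}, j) \<notin> E" "({w, x}, k) \<notin> E" "({x, u}, l) \<notin> E"
  shows "cycle_decomp (K4 \<mu>) a b (Suc c)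
    (insert ({u, v}, i) (insert ({v, w}, j) (insert ({w, x}, k) (insert ({x, u}, l) E))))"
  by (rule cycle_decomp_square[OF wf_complete_multigraph assms(1)]) (use assms in auto)

lemmas K4_steps = K4_digon K4_triangle K4_square cycle_decomp_empty

lemma eq_Diff_pair:
  "insert x (insert y S) = T \<Longrightarrow> x \<notin> S \<Longrightarrow> y \<notin> S \<Longrightarrow> S = T - {x, y}"
  by blast

lemma two_layers:
  assumes ij: "i < \<mu>" "j < \<mu>" "i \<noteq> j"
    and type: "(a, b, c) \<in> {(6,0,0), (3,2,0), (0,4,0), (1,2,1), (2,0,2), (0,0,3)}"
  shows "cycle_decomp (K4 \<mu>) a b c (pairs4 \<times> {i, j})"
proof -
  \<comment> \<open>In each list the digons come first, then the triangles, then the 4-cycles.\<close>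
  note edge_simps = ij ij(3)[symmetric] pairs4_def doubleton_eq_iff
  let ?P = "cycle_decomp (K4 \<mu>)"
  have t1: "?P (Suc (Suc (Suc (Suc (Suc (Suc 0)))))) 0 0 (pairs4 \<times> {i, j})"
  proof -
    have "?P (Suc (Suc (Suc (Suc (Suc (Suc 0)))))) 0 0
     {({0,1},i),({0,1},j), ({0,2},i),({0,2},j), ({0,3},i),({0,3},j),
      ({1,2},i),({1,2},j), ({1,3},i),({1,3},j), ({2,3},i),({2,3},j)}"
      (is "cycle_decomp _ _ _ _ ?S")
      by (intro K4_steps) (simp_all add: edge_simps)
    also have "?S = pairs4 \<times> {i, j}"
      unfolding pair_orientation pairs4_Times by (simp add: set_eq_subset)
    finally show ?thesis .
  qed
  have t2: "?P (Suc (Suc (Suc 0))) (Suc (Suc 0)) 0 (pairs4 \<times> {i, j})"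
  proof -
    have "?P (Suc (Suc (Suc 0))) (Suc (Suc 0)) 0
     {({0,3},i),({0,3},j), ({1,3},i),({1,3},j), ({2,3},i),({2,3},j),
      ({0,1},i),({1,2},i),({2,0},i), ({0,1},j),({1,2},j),({2,0},j)}"
      (is "cycle_decomp _ _ _ _ ?S")
      by (intro K4_steps) (simp_all add: edge_simps)
    also have "?S = pairs4 \<times> {i, j}"
      unfolding pair_orientation pairs4_Times by (simp add: set_eq_subset)
    finally show ?thesis .
  qed
  have t3: "?P 0 (Suc (Suc (Suc (Suc 0)))) 0 (pairs4 \<times> {i, j})"
  proof -
    have "?P 0 (Suc (Suc (Suc (Suc 0)))) 0
     {({0,1},i),({1,2},i),({2,0},i), ({0,1},j),({1,3},i),({3,0},i),
      ({0,2},j),({2,3},i),({3,0},j), ({1,2},j),({2,3},j),({3,1},j)}"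
      (is "cycle_decomp _ _ _ _ ?S")
      by (intro K4_steps) (simp_all add: edge_simps)
    also have "?S = pairs4 \<times> {i, j}"
      unfolding pair_orientation pairs4_Times by (simp add: set_eq_subset)
    finally show ?thesis .
  qed
  have t4: "?P (Suc 0) (Suc (Suc 0)) (Suc 0) (pairs4 \<times> {i, j})"
  proof -
    have "?P (Suc 0) (Suc (Suc 0)) (Suc 0)
     {({2,3},i),({2,3},j), ({0,1},i),({1,2},i),({2,0},i), ({0,1},j),({1,3},i),({3,0},i),
      ({0,2},j),({2,1},j),({1,3},j),({3,0},j)}"
      (is "cycle_decomp _ _ _ _ ?S")
      by (intro K4_steps) (simp_all add: edge_simps)
    also have "?S = pairs4 \<times> {i, j}"
      unfolding pair_orientation pairs4_Times by (simp add: set_eq_subset)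
    finally show ?thesis .
  qed
  have t5: "?P (Suc (Suc 0)) 0 (Suc (Suc 0)) (pairs4 \<times> {i, j})"
  proof -
    have "?P (Suc (Suc 0)) 0 (Suc (Suc 0))
     {({0,2},i),({0,2},j), ({1,3},i),({1,3},j),
      ({0,1},i),({1,2},i),({2,3},i),({3,0},i), ({0,1},j),({1,2},j),({2,3},j),({3,0},j)}"
      (is "cycle_decomp _ _ _ _ ?S")
      by (intro K4_steps) (simp_all add: edge_simps)
    also have "?S = pairs4 \<times> {i, j}"
      unfolding pair_orientation pairs4_Times by (simp add: set_eq_subset)
    finally show ?thesis .
  qed
  have t6: "?P 0 0 (Suc (Suc (Suc 0))) (pairs4 \<times> {i, j})"
  proof -
    have "?P 0 0 (Suc (Suc (Suc 0)))
     {({0,1},i),({1,2},i),({2,3},i),({3,0},i), ({0,1},j),({1,3},i),({3,2},j),({2,0},i),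
      ({0,2},j),({2,1},j),({1,3},j),({3,0},j)}"
      (is "cycle_decomp _ _ _ _ ?S")
      by (intro K4_steps) (simp_all add: edge_simps)
    also have "?S = pairs4 \<times> {i, j}"
      unfolding pair_orientation pairs4_Times by (simp add: set_eq_subset)
    finally show ?thesis .
  qed
  from t1 t2 t3 t4 t5 t6 show ?thesis
    using type by (auto simp: numeral_eq_Suc)
qed

lemma one_layer:
  assumes i: "i < \<mu>"
  shows "cycle_decomp (K4 \<mu>) 0 0 1 (pairs4 \<times> {i} - {({0,1}, i), ({2,3}, i)})"
proof -
  note edge_simps = i pairs4_def doubleton_eq_iff
  have "cycle_decomp (K4 \<mu>) 0 0 (Suc 0) {({0,2},i),({2,1},i),({1,3},i),({3,0},i)}"
    by (intro K4_steps) (simp_all add: edge_simps)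
  moreover have "{({0,2},i),({2,1},i),({1,3},i),({3,0},i)} =
      pairs4 \<times> {i} - {({0,1}, i), ({2,3}, i)}"
    unfolding pair_orientation pairs4_Times
    by (simp add: doubleton_eq_iff insert_Diff_if insert_commute)
  ultimately show ?thesis by simp
qed

text \<open>
  Every pair joined by the 1-factor must keep an even number of edges, and every other pair an odd
  number, in the union of the triangles and 4-cycles. Two distinct 4-cycles \<open>0123\<close>, \<open>0132\<close> share
  exactly the pairs of the 1-factor, and two triangles sharing the edge \<open>01\<close> have a 4-cycle as their
  symmetric difference, so both meet this condition; a repeated triangle does not affect it. All
  remaining edges can then be grouped into digons.
\<close>

lemma three_layers:
  assumes ijk: "i < \<mu>" "j < \<mu>" "k < \<mu>" "distinct [i, j, k]"
    and type: "(a, b, c) \<in> {(4,0,2), (5,2,0), (2,4,0)}"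
  shows "cycle_decomp (K4 \<mu>) a b c (pairs4 \<times> {i, j, k} - {({0,1}, i), ({2,3}, i)})"
proof -
  have ne: "i \<noteq> j" "i \<noteq> k" "j \<noteq> k" "j \<noteq> i" "k \<noteq> i" "k \<noteq> j" using ijk by auto
  note edge_simps = ijk(1-3) ne pairs4_def doubleton_eq_iff
  let ?P = "cycle_decomp (K4 \<mu>)"
  let ?E = "pairs4 \<times> {i, j, k} - {({0,1}, i), ({2,3}, i)}"
  have t1: "?P (Suc (Suc (Suc (Suc 0)))) 0 (Suc (Suc 0)) ?E"
  proof -
    have "?P (Suc (Suc (Suc (Suc 0)))) 0 (Suc (Suc 0))
     {({0,2},i),({0,2},j), ({1,3},i),({1,3},j), ({0,3},i),({0,3},k), ({1,2},i),({1,2},k),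
      ({0,1},j),({1,2},j),({2,3},j),({3,0},j), ({0,1},k),({1,3},k),({3,2},k),({2,0},k)}"
      (is "cycle_decomp _ _ _ _ ?S")
      by (intro K4_steps) (simp_all add: edge_simps)
    also have "?S = ?E"
    proof (rule eq_Diff_pair)
      show "insert ({0,1}, i) (insert ({2,3}, i) ?S) = pairs4 \<times> {i, j, k}"
        unfolding pair_orientation pairs4_Times by (simp add: set_eq_subset)
    qed (simp_all add: edge_simps)
    finally show ?thesis .
  qed
  have t2: "?P (Suc (Suc (Suc (Suc (Suc 0))))) (Suc (Suc 0)) 0 ?E"
  proof -
    have "?P (Suc (Suc (Suc (Suc (Suc 0))))) (Suc (Suc 0)) 0
     {({2,3},j),({2,3},k), ({0,2},i),({0,2},k), ({1,2},i),({1,2},k), ({1,3},i),({1,3},k),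
      ({0,3},i),({0,3},k), ({0,1},j),({1,2},j),({2,0},j), ({0,1},k),({1,3},j),({3,0},j)}"
      (is "cycle_decomp _ _ _ _ ?S")
      by (intro K4_steps) (simp_all add: edge_simps)
    also have "?S = ?E"
    proof (rule eq_Diff_pair)
      show "insert ({0,1}, i) (insert ({2,3}, i) ?S) = pairs4 \<times> {i, j, k}"
        unfolding pair_orientation pairs4_Times by (simp add: set_eq_subset)
    qed (simp_all add: edge_simps)
    finally show ?thesis .
  qed
  have t3: "?P (Suc (Suc 0)) (Suc (Suc (Suc (Suc 0)))) 0 ?E"
  proof -
    have "?P (Suc (Suc 0)) (Suc (Suc (Suc (Suc 0)))) 0
     {({1,2},i),({1,2},k), ({1,3},i),({1,3},k),
      ({0,1},j),({1,2},j),({2,0},j), ({0,1},k),({1,3},j),({3,0},j),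
      ({0,2},i),({2,3},j),({3,0},i), ({0,2},k),({2,3},k),({3,0},k)}"
      (is "cycle_decomp _ _ _ _ ?S")
      by (intro K4_steps) (simp_all add: edge_simps)
    also have "?S = ?E"
    proof (rule eq_Diff_pair)
      show "insert ({0,1}, i) (insert ({2,3}, i) ?S) = pairs4 \<times> {i, j, k}"
        unfolding pair_orientation pairs4_Times by (simp add: set_eq_subset)
    qed (simp_all add: edge_simps)
    finally show ?thesis .
  qed
  from t1 t2 t3 show ?thesis
    using type by (auto simp: numeral_eq_Suc)
qed

section \<open>Sufficiency\<close>

text \<open>
  Removing six digons does not change \<open>(b, c)\<close>, so only \<open>a < 6\<close> needs care. The type \<open>(0,0,3)\<close>
  then disposes of \<open>c \<ge> 3\<close>, except for \<open>(b, c) = (0, 4)\<close>, where it would leave a single 4-cycle.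
  If \<open>c \<le> 2\<close>, four triangles can be removed when \<open>b \<ge> 6\<close>; for smaller \<open>b\<close>, which is even, the
  equation modulo 12 guarantees as many digons as the chosen type needs.
\<close>

lemma ex_two_layer_type:
  fixes a b c :: nat
  assumes eq: "2 * a + 3 * b + 4 * c = 12 * Suc m" and ne: "(b, c) \<noteq> (0, 1)"
  obtains x y z where "(x, y, z) \<in> {(6,0,0), (3,2,0), (0,4,0), (1,2,1), (2,0,2), (0,0,3)}"
    "x \<le> a" "y \<le> b" "z \<le> c" "(b - y, c - z) \<noteq> (0, 1)"
proof -
  have "even b" using eq by presburger
  then obtain d where d: "b = 2 * d" by (elim evenE)
  show ?thesis
  proof (cases "a \<ge> 6")
    case True
    then show ?thesis using ne by (intro that[of 6 0 0]) auto
  next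
    case small: False
    have "b = 0 \<or> b = 2 \<or> b = 4 \<or> b \<ge> 6" using d by presburger
    then consider "c \<ge> 3" "b > 0 \<or> c \<noteq> 4" | "b = 0" "c = 4" | "c \<le> 2" "b \<ge> 6"
      | "c \<le> 2" "b = 4" | "c \<le> 2" "b = 2" | "c \<le> 2" "b = 0"
      by fastforce
    then show ?thesis
    proof cases
      case 1 then show ?thesis by (intro that[of 0 0 3]) auto
    next
      case 2
      then have "a \<ge> 2" using eq by presburger
      then show ?thesis using 2 by (intro that[of 2 0 2]) auto
    next
      case 3 then show ?thesis by (intro that[of 0 4 0]) auto
    next
      case 4
      show ?thesis
      proof (cases "c = 1")
        case True
        then have "a \<ge> 1" using 4 eq by presburger
        then show ?thesis using True 4 by (intro that[of 1 2 1]) auto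
      next
        case False
        then show ?thesis using 4 by (intro that[of 0 4 0]) auto
      qed
    next
      case 5
      show ?thesis
      proof (cases "c = 1")
        case True
        then have "a \<ge> 1" using 5 eq by presburger
        then show ?thesis using True 5 by (intro that[of 1 2 1]) auto
      next
        case False
        then have "a \<ge> 3" using 5 eq by presburger
        then show ?thesis using False 5 by (intro that[of 3 2 0]) auto
      qed
    next
      case 6
      then have "a \<ge> 2 \<and> c = 2" using small eq ne by auto
      then show ?thesis using 6 by (intro that[of 2 0 2]) auto
    qed
  qed
qed

lemma even_layers:
  fixes a b c :: nat
  assumes "2 * a + 3 * b + 4 * c = 12 * m" "(b, c) \<noteq> (0, 1)" "k + 2 * m \<le> \<mu>"
  shows "cycle_decomp (K4 \<mu>) a b c (pairs4 \<times> {k..<k + 2 * m})"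
  using assms
proof (induction m arbitrary: a b c)
  case 0
  then show ?case by (simp add: cycle_decomp_empty)
next
  case (Suc m)
  obtain x y z where xyz: "(x, y, z) \<in> {(6,0,0), (3,2,0), (0,4,0), (1,2,1), (2,0,2), (0,0,3)}"
    and le: "x \<le> a" "y \<le> b" "z \<le> c" and ne: "(b - y, c - z) \<noteq> (0, 1)"
    using ex_two_layer_type[OF Suc.prems(1,2)] by blast
  have "2 * (a - x) + 3 * (b - y) + 4 * (c - z) = 12 * m"
    using xyz le Suc.prems(1) by auto
  then have "cycle_decomp (K4 \<mu>) (a - x) (b - y) (c - z) (pairs4 \<times> {k..<k + 2 * m})"
    using Suc.IH[OF _ ne] Suc.prems(3) by simp
  moreover have "cycle_decomp (K4 \<mu>) x y z (pairs4 \<times> {k + 2 * m, k + 2 * m + 1})"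
    using Suc.prems(3) by (intro two_layers xyz) auto
  ultimately have "cycle_decomp (K4 \<mu>) (a - x + x) (b - y + y) (c - z + z)
      (pairs4 \<times> {k..<k + 2 * m} \<union> pairs4 \<times> {k + 2 * m, k + 2 * m + 1})"
    by (intro cycle_decomp_Un) auto
  moreover have "pairs4 \<times> {k..<k + 2 * m} \<union> pairs4 \<times> {k + 2 * m, k + 2 * m + 1} =
      pairs4 \<times> {k..<k + 2 * Suc m}"
    by auto
  ultimately show ?case using le by simp
qed

lemma CD_K4_sufficient_even:
  assumes "even \<mu>" "2 * a + 3 * b + 4 * c = 6 * \<mu>" "(b, c) \<noteq> (0, 1)"
  shows "\<exists>D. is_CD234 a b c (K4 \<mu>) D"
proof (rule CD_of_cycle_decomp_even[OF assms(1)])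
  show "cycle_decomp (K4 \<mu>) a b c (edges (K4 \<mu>))"
    using even_layers[of a b c "\<mu> div 2" 0 \<mu>] assms by (simp add: lessThan_atLeast0)
qed

text \<open>
  Next to the 1-factor, a single layer supplies one 4-cycle. This fails only if there is no 4-cycle
  to be supplied, or if \<open>(b, c) = (0, 2)\<close>, where a forbidden single 4-cycle would remain for the
  even number of other layers. The three types for three layers cover these cases.
\<close>

lemma ex_odd_layer_type:
  fixes a b c :: nat
  assumes odd: "odd \<mu>" and eq: "2 * a + 3 * b + 4 * c = 6 * \<mu> - 2" and ne: "(b, c) \<noteq> (0, 0)"
  obtains (one) "c \<ge> 1" "(b, c - 1) \<noteq> (0, 1)"
    | (three) x y z where "(x, y, z) \<in> {(4,0,2), (5,2,0), (2,4,0)}" "\<mu> \<ge> 3"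
      "x \<le> a" "y \<le> b" "z \<le> c" "(b - y, c - z) \<noteq> (0, 1)"
proof -
  obtain n where n: "\<mu> = 2 * n + 1" using odd by (elim oddE)
  have eq': "2 * a + 3 * b + 4 * c = 12 * n + 4" using eq by (simp add: n)
  then have "even b" by presburger
  then obtain d where d: "b = 2 * d" by (elim evenE)
  have eq2: "a + 3 * d + 2 * c = 6 * n + 2" using eq' d by simp
  have mu: "\<mu> \<ge> 3" if "n \<noteq> 0" using that n by simp
  consider "c \<ge> 1" "(b, c) \<noteq> (0, 2)" | "b = 0" "c = 2" | "c = 0" "a \<ge> 5" | "c = 0" "a < 5"
    by fastforce
  then show ?thesis
  proof cases
    case 1
    then show ?thesis by (intro one) auto
  next
    case 2
    then have "n \<noteq> 0" "a \<ge> 4" using eq2 d by presburger+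
    then show ?thesis using 2 mu by (intro three[of 4 0 2]) auto
  next
    case 3
    then have "n \<noteq> 0" "b \<ge> 2" using ne eq2 d by auto
    then show ?thesis using 3 mu by (intro three[of 5 2 0]) auto
  next
    case 4
    have "d > 0" using 4 ne d by simp
    then have "n \<noteq> 0" using 4 eq2 by presburger
    moreover have "a = 2" using 4 eq2 by presburger
    moreover from calculation have "d \<ge> 2" using 4 eq2 by presburger
    ultimately show ?thesis using 4 mu d by (intro three[of 2 4 0]) auto
  qed
qed

lemma CD_K4_sufficient_odd:
  assumes odd: "odd \<mu>" and eq: "2 * a + 3 * b + 4 * c = 6 * \<mu> - 2" and ne: "(b, c) \<noteq> (0, 0)"
  shows "\<exists>D. is_CD234 a b c (K4 \<mu>) D"
proof -
  have pos: "\<mu> > 0" using odd by (cases \<mu>) auto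
  let ?F = "{({0,1}, 0), ({2,3}, 0)} :: (nat set \<times> nat) set"
  have F: "?F \<subseteq> pairs4 \<times> {0}" by (simp add: pairs4_def)
  have "cycle_decomp (K4 \<mu>) a b c (edges (K4 \<mu>) - ?F)"
    using odd eq ne
  proof (cases rule: ex_odd_layer_type)
    case one
    define m where "m = (\<mu> - 1) div 2"
    have m: "\<mu> = 1 + 2 * m" using odd unfolding m_def by presburger
    have "cycle_decomp (K4 \<mu>) a b (c - 1) (pairs4 \<times> {1..<1 + 2 * m})"
      using one eq m by (intro even_layers) auto
    then have "cycle_decomp (K4 \<mu>) (0 + a) (0 + b) (1 + (c - 1))
        (pairs4 \<times> {0} \<union> pairs4 \<times> {1..<1 + 2 * m} - ?F)"
      using pos F by (intro cycle_decomp_Un_Diff one_layer) auto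
    moreover have "{..<\<mu>} = {0} \<union> {1..<1 + 2 * m}" using m by auto
    then have "edges (K4 \<mu>) = pairs4 \<times> {0} \<union> pairs4 \<times> {1..<1 + 2 * m}"
      by (simp only: K4_simps Sigma_Un_distrib2)
    ultimately show ?thesis using one(1) by (simp del: K4_simps)
  next
    case (three x y z)
    define m where "m = (\<mu> - 3) div 2"
    have m: "\<mu> = 3 + 2 * m" using odd three(2) unfolding m_def by presburger
    have "2 * (a - x) + 3 * (b - y) + 4 * (c - z) = 12 * m"
      using three eq m by auto
    then have "cycle_decomp (K4 \<mu>) (a - x) (b - y) (c - z) (pairs4 \<times> {3..<3 + 2 * m})"
      using three m by (intro even_layers) auto
    moreover have "cycle_decomp (K4 \<mu>) x y z (pairs4 \<times> {0, 1, 2} - ?F)"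
      using three(1,2) by (intro three_layers) auto
    ultimately have "cycle_decomp (K4 \<mu>) (x + (a - x)) (y + (b - y)) (z + (c - z))
        (pairs4 \<times> {0, 1, 2} \<union> pairs4 \<times> {3..<3 + 2 * m} - ?F)"
      using F by (intro cycle_decomp_Un_Diff) auto
    moreover have "{..<\<mu>} = {0, 1, 2} \<union> {3..<3 + 2 * m}" using m by auto
    then have "edges (K4 \<mu>) = pairs4 \<times> {0, 1, 2} \<union> pairs4 \<times> {3..<3 + 2 * m}"
      by (simp only: K4_simps Sigma_Un_distrib2)
    ultimately show ?thesis using three(3-5) by (simp del: K4_simps)
  qed
  then show ?thesis by (rule CD_of_cycle_decomp_odd[OF odd pos])
qed

theorem lemma5p3:
  fixes \<mu> a b c :: nat
  assumes "\<mu> > 0"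
  shows "(\<exists>D. is_CD234 a b c (complete_multigraph \<mu> 4) D) \<longleftrightarrow>
    (2 * a + 3 * b + 4 * c = 6 * \<mu> - (if even \<mu> then 0 else 2) \<and>
     (if even \<mu> then (b, c) \<noteq> (0, 1) else (b, c) \<noteq> (0, 0)))"
  using CD_K4_necessary[of a b c \<mu>] CD_K4_sufficient_even[of \<mu> a b c]
    CD_K4_sufficient_odd[of \<mu> a b c]
  by (cases "even \<mu>") auto

end
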